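(* Let $X$ be a closed set in a complete metric space $(Y,d)$. If $F\colon X\to 2^{Y}$ is a closed-valued $\alpha$-contraction such that $F(x)\subset\tilde{I}_{X}(x)$ for all $x\in X$, then for each $\epsilon>0$ with $\alpha+\epsilon<1$ the following is satisfied: for each $x\in X\setminus F(x)$ and $t\in F(x)$ there exist $z\in X\setminus\{x\}$ and $v\in F(z)$ such that $$(1-\alpha-\epsilon)\max\{d(x,z),\,d(t,v)/(\alpha+\epsilon)\}\le d(x,t)-d(z,v),$$ and $F$ has a fixed point.
   Context: $2^{Y}$ is the family of all subsets of $Y$; a mapping $F\colon X\to 2^{Y}$ is understood to satisfy $X\neq\emptyset$ and $F(x)\neq\emptyset$ for all $x\in X$. "For each $x\in X\setminus F(x)$" means for each $x\in X$ with $x\notin F(x)$. For a nonempty $A\subset Y$, $d(x,A)=d(A,x)=\inf_{a\in A}d(x,a)$. For nonempty $A,B\subset Y$, $D(A,B)=\max\{\sup_{a\in A}d(a,B),\sup_{b\in B}d(A,b)\}$ whenever this is finite (Hausdorff distance). For $0\le\alpha<1$, $F$ is an $\alpha$-contraction if $D(F(y),F(x))\le\alpha\,d(y,x)$ (in particular, $D(F(y),F(x))$ is finite) for all $x,y\in X$. A fixed point of $F$ is an $x\in X$ with $x\in F(x)$. For $x,t\in Y$ the metric segment is $[x,t]=\{s\in Y\colon d(x,s)+d(s,t)=d(x,t)\}$, and $(x,t]=[x,t]\setminus\{x\}$. For nonempty $X\subset Y$ and $x\in X$, the generalized inward set is $$\tilde{I}_{X}(x)=\{x\}\cup\{t\in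 Y\colon \text{for each }\beta>0\text{ there exist } s\in(x,t]\text{ and } z\in X\text{ such that } d(z,s)\le\beta\,d(x,s)\}.$$ *)

theory Defs
  imports "HOL-Analysis.Analysis"
begin

(* Metric segment [x,t] in an arbitrary metric space; no linear structure, so this is
   not closed_segment. *)
definition metric_segment :: "'a::metric_space \<Rightarrow> 'a \<Rightarrow> 'a set" where
  "metric_segment x t = {s. dist x s + dist s t = dist x t}"

(* The half-open segment (x,t]. *)
definition metric_segment_open_left :: "'a::metric_space \<Rightarrow> 'a \<Rightarrow> 'a set" where
  "metric_segment_open_left x t = metric_segment x t - {x}"

definition generalized_inward :: "'a::metric_space set \<Rightarrow> 'a \<Rightarrow> 'a set" where
  "generalized_inward X x =
     {x} \<union> {t. \<forall>\<beta>>0. \<exists>s\<in>metric_segment_open_left x t. \<exists>z\<in>X. dist z s \<le> \<beta> * dist x s}"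

(* Hausdorff distance, meant for nonempty A and B. It is extended-real valued, so that
   sets at infinite distance have distance \<infinity> instead of the arbitrary value of an
   unbounded real supremum. *)
definition hausdorff_distance :: "'a::metric_space set \<Rightarrow> 'a set \<Rightarrow> ereal" where
  "hausdorff_distance A B =
     max (SUP a\<in>A. ereal (infdist a B)) (SUP b\<in>B. ereal (infdist b A))"

(* F is a mapping from X to the nonempty subsets of the space, with X nonempty;
   values of F outside X are irrelevant. *)
definition set_valued_map :: "'a set \<Rightarrow> ('a \<Rightarrow> 'b set) \<Rightarrow> bool" where
  "set_valued_map X F \<longleftrightarrow> X \<noteq> {} \<and> (\<forall>x\<in>X. F x \<noteq> {})"

(* The bound by a real number includes finiteness of the Hausdorff distance. *)
definition alpha_contraction ::
    "real \<Rightarrow> 'a::metric_space set \<Rightarrow> ('a \<Rightarrow> 'a set) \<Rightarrow> bool" where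
  "alpha_contraction \<alpha> X F \<longleftrightarrow> 0 \<le> \<alpha> \<and> \<alpha> < 1 \<and>
     (\<forall>x\<in>X. \<forall>y\<in>X. hausdorff_distance (F y) (F x) \<le> ereal (\<alpha> * dist y x))"

end

theory Submission
  imports Defs
begin

text \<open>
  Take \<open>x \<notin> F x\<close> and \<open>t \<in> F x\<close>. Since \<open>t\<close> is a generalized inward point, one can walk from \<open>x\<close>
  along the metric segment to some \<open>s\<close> and then jump to a point \<open>z\<close> of \<open>X\<close> with an error that is
  negligible compared to \<open>dist x s\<close>. The walk decreases the distance to \<open>t\<close> by \<open>dist x s\<close>, which is
  almost \<open>dist x z\<close>; the contraction moves \<open>t\<close> to some \<open>v \<in> F z\<close> at a cost of hardly more than
  \<open>\<alpha> * dist x z\<close>. Altogether \<open>dist z v\<close> is smaller than \<open>dist x t\<close> by at least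
  \<open>(1 - \<alpha> - \<epsilon>) * dist x z\<close>. As \<open>dist t v / (\<alpha> + \<epsilon>) \<le> dist x z\<close>, this is the claimed inequality
  (\<open>inward_contraction_descent\<close>).

  This inequality says that on the graph of \<open>F\<close> the function \<open>(x, t) \<mapsto> dist x t\<close> can always be
  decreased by at least a constant multiple of the distance travelled in the graph, as long as \<open>x\<close>
  is not a fixed point. The graph is closed (\<open>closed_graph_of_contraction\<close>), hence complete, so the variational
  principle \<open>Caristi_Ekeland_point\<close> gives a pair from which no such descent is possible.
  The first component of that pair is a fixed point.
\<close>

section \<open>A variational principle in complete metric spaces\<close>

text \<open>
  Write \<open>S x\<close> for the set of points reachable from \<open>x\<close> by a descent that pays for the distance; by
  the triangle inequality reachability is transitive. Going each time to a reachable point whose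
  value is at most halfway above the infimum of \<open>\<phi>\<close> over \<open>S x\<close>, one gets a sequence whose
  distances are bounded by the differences of its decreasing, bounded values, so it is Cauchy. Its limit is
  reachable from every member of the sequence, and so is every point reachable from the
  limit; by the halving such a point cannot have a smaller value than the limit.
\<close>
lemma Caristi_Ekeland_point:
  fixes C :: "'b::metric_space set" and \<phi> :: "'b \<Rightarrow> real"
  assumes "complete C" and "C \<noteq> {}" and cont: "continuous_on C \<phi>"
    and nonneg: "\<And>x. x \<in> C \<Longrightarrow> 0 \<le> \<phi> x"
  shows "\<exists>x\<in>C. \<forall>y\<in>C. dist x y \<le> \<phi> x - \<phi> y \<longrightarrow> y = x"
proof -
  define S where "S x = {y \<in> C. dist x y \<le> \<phi> x - \<phi> y}" for x
  have S_refl: "x \<in> S x" if "x \<in> C" for x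
    using that by (simp add: S_def)
  have S_trans: "z \<in> S x" if "y \<in> S x" "z \<in> S y" for x y z
    using that dist_triangle[of x z y] by (auto simp: S_def)
  have S_C: "S x \<subseteq> C" for x
    by (auto simp: S_def)
  have bdd: "bdd_below (\<phi> ` S x)" for x
    using nonneg S_C by (intro bdd_belowI2[of _ 0]) blast
  have step: "\<exists>y\<in>S x. 2 * \<phi> y \<le> \<phi> x + Inf (\<phi> ` S x)" if x: "x \<in> C" for x
  proof (cases "Inf (\<phi> ` S x) < \<phi> x")
    case True
    then have "Inf (\<phi> ` S x) < (\<phi> x + Inf (\<phi> ` S x)) / 2"
      by simp
    moreover have "S x \<noteq> {}"
      using S_refl[OF x] by blast
    ultimately obtain y where "y \<in> S x" "\<phi> y < (\<phi> x + Inf (\<phi> ` S x)) / 2"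
      using cINF_less_iff[OF _ bdd] by blast
    then show ?thesis
      by (intro bexI[of _ y]) auto
  next
    case False
    then show ?thesis
      using S_refl[OF x] by (intro bexI[of _ x]) auto
  qed
  obtain x0 where x0: "x0 \<in> C"
    using \<open>C \<noteq> {}\<close> by blast
  obtain X where X_C: "\<And>n. X n \<in> C"
    and X_step: "\<And>n. X (Suc n) \<in> S (X n) \<and> 2 * \<phi> (X (Suc n)) \<le> \<phi> (X n) + Inf (\<phi> ` S (X n))"
  proof -
    have "\<exists>f. \<forall>n. f n \<in> C \<and> (f (Suc n) \<in> S (f n) \<and>
            2 * \<phi> (f (Suc n)) \<le> \<phi> (f n) + Inf (\<phi> ` S (f n)))"
    proof (rule dependent_nat_choice)
      show "\<exists>y. y \<in> C \<and> (y \<in> S x \<and> 2 * \<phi> y \<le> \<phi> x + Inf (\<phi> ` S x))" if "x \<in> C" for x n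
        using step[OF that] S_C[of x] by auto
    qed (use x0 in auto)
    then obtain f where "\<forall>n. f n \<in> C \<and> (f (Suc n) \<in> S (f n) \<and>
            2 * \<phi> (f (Suc n)) \<le> \<phi> (f n) + Inf (\<phi> ` S (f n)))" ..
    then show thesis
      by (intro that[of f]) auto
  qed
  have X_reach: "X n \<in> S (X m)" if "m \<le> n" for m n
    using that
  proof (induction n rule: dec_induct)
    case base
    show ?case by (rule S_refl[OF X_C])
  next
    case (step n)
    then show ?case
      using S_trans X_step by blast
  qed
  have "decseq (\<lambda>n. \<phi> (X n))"
  proof (rule decseq_SucI)
    fix n
    have "dist (X n) (X (Suc n)) \<le> \<phi> (X n) - \<phi> (X (Suc n))"
      using X_step[of n] by (simp add: S_def)
    then show "\<phi> (X (Suc n)) \<le> \<phi> (X n)"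
      using zero_le_dist[of "X n" "X (Suc n)"] by linarith
  qed
  then obtain l where l: "(\<lambda>n. \<phi> (X n)) \<longlonglongrightarrow> l" "\<And>n. l \<le> \<phi> (X n)"
    using decseq_convergent[of "\<lambda>n. \<phi> (X n)" 0] nonneg[OF X_C] by blast
  have "Cauchy X"
  proof (rule metric_CauchyI)
    fix e :: real
    assume "e > 0"
    then have "\<forall>\<^sub>F n in sequentially. \<phi> (X n) < l + e / 2"
      by (intro order_tendstoD(2)[OF l(1)]) simp
    then obtain N where N: "\<phi> (X N) < l + e / 2"
      by (auto simp: eventually_sequentially)
    have near: "dist (X N) (X n) < e / 2" if "N \<le> n" for n
      using X_reach[OF that] l(2)[of n] N by (simp add: S_def)
    have "dist (X m) (X n) < e" if "N \<le> m" "N \<le> n" for m n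
      using near[OF that(1)] near[OF that(2)] by (rule dist_triangle_half_r)
    then show "\<exists>M. \<forall>m\<ge>M. \<forall>n\<ge>M. dist (X m) (X n) < e"
      by blast
  qed
  then obtain p where p: "p \<in> C" "X \<longlonglongrightarrow> p"
    using \<open>complete C\<close> X_C unfolding complete_def by blast
  have \<phi>_lim: "(\<lambda>n. \<phi> (X n)) \<longlonglongrightarrow> \<phi> p"
    using continuous_on_tendsto_compose[OF cont p(2,1)] X_C by simp
  have p_reach: "p \<in> S (X m)" for m
  proof -
    have "dist (X m) p \<le> \<phi> (X m) - \<phi> p"
    proof (rule LIMSEQ_le)
      show "(\<lambda>n. dist (X m) (X n)) \<longlonglongrightarrow> dist (X m) p"
        by (intro tendsto_intros p)
      show "(\<lambda>n. \<phi> (X m) - \<phi> (X n)) \<longlonglongrightarrow> \<phi> (X m) - \<phi> p"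
        by (intro tendsto_intros \<phi>_lim)
      show "\<exists>N. \<forall>n\<ge>N. dist (X m) (X n) \<le> \<phi> (X m) - \<phi> (X n)"
        using X_reach[of m] by (auto simp: S_def)
    qed
    then show ?thesis
      using p(1) by (simp add: S_def)
  qed
  have "y = p" if y: "y \<in> C" "dist p y \<le> \<phi> p - \<phi> y" for y
  proof -
    have "2 * \<phi> (X (Suc n)) - \<phi> (X n) \<le> \<phi> y" for n
    proof -
      have "y \<in> S (X n)"
        using S_trans[OF p_reach] y by (simp add: S_def)
      then have "Inf (\<phi> ` S (X n)) \<le> \<phi> y"
        by (intro cInf_lower bdd) auto
      then show ?thesis
        using X_step[of n] by linarith
    qed
    moreover have "(\<lambda>n. 2 * \<phi> (X (Suc n)) - \<phi> (X n)) \<longlonglongrightarrow> 2 * \<phi> p - \<phi> p"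
      by (intro tendsto_intros \<phi>_lim LIMSEQ_Suc[OF \<phi>_lim])
    ultimately have "2 * \<phi> p - \<phi> p \<le> \<phi> y"
      by (intro LIMSEQ_le_const2) auto
    then have "dist p y \<le> 0"
      using y(2) by linarith
    then show ?thesis
      by simp
  qed
  then show ?thesis
    using p(1) by blast
qed

section \<open>Set-valued contractions\<close>

lemma infdist_le_of_contraction:
  assumes "alpha_contraction \<alpha> X F" "x \<in> X" "y \<in> X" "t \<in> F x"
  shows "infdist t (F y) \<le> \<alpha> * dist x y"
proof -
  have "ereal (infdist t (F y)) \<le> (SUP a\<in>F x. ereal (infdist a (F y)))"
    using assms(4) by (rule SUP_upper)
  also have "\<dots> \<le> hausdorff_distance (F x) (F y)"
    by (simp add: hausdorff_distance_def)
  also have "\<dots> \<le> ereal (\<alpha> * dist x y)"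
    using assms(1-3) by (simp add: alpha_contraction_def)
  finally show ?thesis
    by simp
qed

text \<open>
  If \<open>(u n, w n)\<close> in the graph tends to \<open>(x, t)\<close>, then \<open>w n\<close> is within \<open>\<alpha> * dist (u n) x\<close> of \<open>F x\<close>, so
  \<open>t\<close> has distance 0 from the closed set \<open>F x\<close>.
\<close>
lemma closed_graph_of_contraction:
  fixes X :: "'a::metric_space set"
  assumes "closed X" and "set_valued_map X F" and closed_values: "\<forall>x\<in>X. closed (F x)"
    and contr: "alpha_contraction \<alpha> X F"
  shows "closed (Sigma X F)"
  unfolding closed_sequential_limits
proof (intro allI impI, elim conjE)
  fix p l
  assume p: "\<forall>n. p n \<in> Sigma X F" and lim: "p \<longlonglongrightarrow> l"
  obtain x t where l: "l = (x, t)"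
    by (cases l)
  define u where "u n = fst (p n)" for n
  define w where "w n = snd (p n)" for n
  have uw: "u n \<in> X" "w n \<in> F (u n)" for n
    using p[rule_format, of n] by (auto simp: u_def w_def)
  have u_lim: "u \<longlonglongrightarrow> x" and w_lim: "w \<longlonglongrightarrow> t"
    using tendsto_fst[OF lim] tendsto_snd[OF lim] by (simp_all add: u_def[abs_def] w_def[abs_def] l)
  have x: "x \<in> X"
    using closed_sequentially[OF \<open>closed X\<close> uw(1) u_lim] .
  have "infdist t (F x) \<le> \<alpha> * dist (u n) x + dist t (w n)" for n
    using infdist_triangle[of t "F x" "w n"] infdist_le_of_contraction[OF contr uw(1) x uw(2), of n]
    by linarith
  moreover have "(\<lambda>n. \<alpha> * dist (u n) x + dist t (w n)) \<longlonglongrightarrow> \<alpha> * dist x x + dist t t"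
    by (intro tendsto_intros u_lim w_lim)
  ultimately have "infdist t (F x) \<le> \<alpha> * dist x x + dist t t"
    by (intro LIMSEQ_le_const) auto
  then have "infdist t (F x) = 0"
    using infdist_nonneg[of t "F x"] by simp
  moreover have "closed (F x)" "F x \<noteq> {}"
    using closed_values x \<open>set_valued_map X F\<close> by (auto simp: set_valued_map_def)
  ultimately have "t \<in> F x"
    using in_closed_iff_infdist_zero by blast
  then show "l \<in> Sigma X F"
    using x l by simp
qed

text \<open>
  The budget \<open>\<epsilon>\<close> is split evenly. One half pays for the error of the jump from the segment into
  \<open>X\<close>, where \<open>\<beta> = \<epsilon> / 4\<close> suffices because \<open>1 - \<beta> \<ge> (1 - 2 * \<beta>) * (1 + \<beta>)\<close>; the other half pays for
  the distance from \<open>t\<close> to \<open>F z\<close> not being attained.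
\<close>
lemma inward_contraction_descent:
  fixes X :: "'a::metric_space set"
  assumes maps: "set_valued_map X F" and contr: "alpha_contraction \<alpha> X F"
    and inward: "F x \<subseteq> generalized_inward X x"
    and \<epsilon>: "0 < \<epsilon>" "\<alpha> + \<epsilon> < 1" and x: "x \<in> X" "x \<notin> F x" and t: "t \<in> F x"
  shows "\<exists>z\<in>X - {x}. \<exists>v\<in>F z.
    (1 - \<alpha> - \<epsilon>) * max (dist x z) (dist t v / (\<alpha> + \<epsilon>)) \<le> dist x t - dist z v"
proof -
  have \<alpha>: "0 \<le> \<alpha>"
    using contr by (simp add: alpha_contraction_def)
  define \<beta> where "\<beta> = \<epsilon> / 4"
  have \<beta>: "0 < \<beta>" "\<beta> < 1" "\<epsilon> = 4 * \<beta>"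
    using \<epsilon> \<alpha> by (auto simp: \<beta>_def)
  have "t \<noteq> x"
    using x t by blast
  then have "\<exists>s\<in>metric_segment_open_left x t. \<exists>z\<in>X. dist z s \<le> \<beta> * dist x s"
    using inward t \<beta>(1) unfolding generalized_inward_def by blast
  then obtain s z where s: "s \<in> metric_segment_open_left x t" and z: "z \<in> X"
    and zs: "dist z s \<le> \<beta> * dist x s"
    by blast
  have seg: "dist x s + dist s t = dist x t" and "s \<noteq> x"
    using s by (auto simp: metric_segment_open_left_def metric_segment_def)
  have xs_pos: "0 < dist x s"
    using \<open>s \<noteq> x\<close> by simp
  have "z \<noteq> x"
  proof
    assume "z = x"
    then have "1 * dist x s \<le> \<beta> * dist x s"
      using zs by simp
    then show False
      using xs_pos \<beta>(2) by (simp only: mult_le_cancel_right_pos)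
  qed
  have Fz: "F z \<noteq> {}"
    using maps z by (simp add: set_valued_map_def)
  have "infdist t (F z) \<le> \<alpha> * dist x z"
    by (rule infdist_le_of_contraction[OF contr x(1) z t])
  also have "\<dots> < (\<alpha> + 2 * \<beta>) * dist x z"
    using \<open>z \<noteq> x\<close> \<beta>(1) by (intro mult_strict_right_mono) auto
  finally obtain v where v: "v \<in> F z" and tv: "dist t v < (\<alpha> + 2 * \<beta>) * dist x z"
    using Fz by (auto simp: infdist_def cINF_less_iff)
  have "dist t v \<le> (\<alpha> + \<epsilon>) * dist x z"
    using less_imp_le[OF tv] mult_right_mono[of "\<alpha> + 2 * \<beta>" "\<alpha> + \<epsilon>" "dist x z"] \<beta> by simp
  then have max: "max (dist x z) (dist t v / (\<alpha> + \<epsilon>)) = dist x z"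
    using \<alpha> \<epsilon> by (intro max_absorb1) (simp add: divide_le_eq mult.commute)
  have "dist x z \<le> dist x s + dist z s"
    using dist_triangle[of x z s] by (simp add: dist_commute)
  then have "dist x z \<le> (1 + \<beta>) * dist x s"
    using zs by (simp add: algebra_simps)
  then have "(1 - 2 * \<beta>) * dist x z \<le> (1 - 2 * \<beta>) * ((1 + \<beta>) * dist x s)"
    using \<beta> \<epsilon> \<alpha> by (intro mult_left_mono) auto
  also have "\<dots> \<le> (1 - \<beta>) * dist x s"
  proof -
    have "(1 - 2 * \<beta>) * (1 + \<beta>) \<le> 1 - \<beta>"
      using \<beta>(1) by (simp add: algebra_simps)
    then show ?thesis
      using mult_right_mono[of "(1 - 2 * \<beta>) * (1 + \<beta>)" "1 - \<beta>" "dist x s"]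
      by (simp add: mult.assoc)
  qed
  also have "\<dots> \<le> dist x s - dist z s"
    using zs by (simp add: algebra_simps)
  finally have gain: "(1 - 2 * \<beta>) * dist x z \<le> dist x s - dist z s" .
  have "dist z v \<le> dist z s + dist s t + dist t v"
    using dist_triangle[of z v s] dist_triangle[of s v t] by linarith
  then have "(1 - 2 * \<beta>) * dist x z - (\<alpha> + 2 * \<beta>) * dist x z \<le> dist x t - dist z v"
    using seg gain tv by linarith
  then have "(1 - \<alpha> - \<epsilon>) * dist x z \<le> dist x t - dist z v"
    by (simp add: \<beta>(3) algebra_simps)
  then show ?thesis
    using z \<open>z \<noteq> x\<close> v max by (intro bexI[of _ z] bexI[of _ v]) auto
qed

section \<open>The fixed point theorem\<close>

theorem theorem3p10:
  fixes X :: "'a::complete_space set" and F :: "'a \<Rightarrow> 'a set" and \<alpha> :: real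
  assumes "closed X"
    and "set_valued_map X F"
    and "\<forall>x\<in>X. closed (F x)"
    and "alpha_contraction \<alpha> X F"
    and "\<forall>x\<in>X. F x \<subseteq> generalized_inward X x"
  shows "(\<forall>\<epsilon>>0. \<alpha> + \<epsilon> < 1 \<longrightarrow>
            (\<forall>x\<in>X. x \<notin> F x \<longrightarrow> (\<forall>t\<in>F x. \<exists>z\<in>X - {x}. \<exists>v\<in>F z.
               (1 - \<alpha> - \<epsilon>) * max (dist x z) (dist t v / (\<alpha> + \<epsilon>)) \<le> dist x t - dist z v)))
         \<and> (\<exists>x\<in>X. x \<in> F x)"
proof
  show "\<forall>\<epsilon>>0. \<alpha> + \<epsilon> < 1 \<longrightarrow>
          (\<forall>x\<in>X. x \<notin> F x \<longrightarrow> (\<forall>t\<in>F x. \<exists>z\<in>X - {x}. \<exists>v\<in>F z.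
             (1 - \<alpha> - \<epsilon>) * max (dist x z) (dist t v / (\<alpha> + \<epsilon>)) \<le> dist x t - dist z v))"
    using inward_contraction_descent[OF assms(2,4)] assms(5) by blast
next
  have \<alpha>: "0 \<le> \<alpha>" "\<alpha> < 1"
    using assms(4) by (auto simp: alpha_contraction_def)
  define \<epsilon> where "\<epsilon> = (1 - \<alpha>) / 2"
  define k where "k = \<alpha> + \<epsilon>"
  have \<epsilon>: "0 < \<epsilon>" and k: "0 < k" "k < 1"
    using \<alpha> by (auto simp: \<epsilon>_def k_def field_simps)
  \<comment> \<open>Because \<open>k < 1\<close>, the product metric is at most twice the maximum in the descent inequality;
    this is where the factor 2 comes from.\<close>
  define \<phi> :: "'a \<times> 'a \<Rightarrow> real" where "\<phi> p = 2 / (1 - k) * dist (fst p) (snd p)" for p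
  have "complete (Sigma X F)"
    using closed_graph_of_contraction[OF assms(1-4)] by (simp add: complete_eq_closed)
  moreover have "Sigma X F \<noteq> {}"
    using assms(2) by (auto simp: set_valued_map_def)
  moreover have "continuous_on (Sigma X F) \<phi>"
    unfolding \<phi>_def by (intro continuous_intros)
  moreover have "0 \<le> \<phi> p" for p
    using k by (simp add: \<phi>_def)
  ultimately obtain p where "p \<in> Sigma X F"
    and "\<forall>q\<in>Sigma X F. dist p q \<le> \<phi> p - \<phi> q \<longrightarrow> q = p"
    using Caristi_Ekeland_point[of "Sigma X F" \<phi>] by blast
  moreover obtain x t where p: "p = (x, t)"
    by (cases p)
  ultimately have x: "x \<in> X" and t: "t \<in> F x"
    and no_descent:
      "\<And>z v. z \<in> X \<Longrightarrow> v \<in> F z \<Longrightarrow> dist (x, t) (z, v) \<le> \<phi> (x, t) - \<phi> (z, v) \<Longrightarrow> z = x"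
    by auto
  have "x \<in> F x"
  proof (rule ccontr)
    assume "x \<notin> F x"
    moreover have "\<alpha> + \<epsilon> < 1"
      using k(2) by (simp add: k_def)
    ultimately obtain z v where z: "z \<in> X" "z \<noteq> x" and v: "v \<in> F z"
      and "(1 - \<alpha> - \<epsilon>) * max (dist x z) (dist t v / (\<alpha> + \<epsilon>)) \<le> dist x t - dist z v"
      using inward_contraction_descent[OF assms(2,4) assms(5)[rule_format, OF x] \<epsilon> _ x _ t] by blast
    then have descent: "(1 - k) * max (dist x z) (dist t v / k) \<le> dist x t - dist z v"
      by (simp add: k_def diff_diff_eq)
    define m where "m = max (dist x z) (dist t v / k)"
    have "dist t v \<le> dist t v / k"
      using k mult_left_le[of k "dist t v"] by (simp add: le_divide_eq)
    then have "dist x z \<le> m" "dist t v \<le> m"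
      by (auto simp: m_def)
    moreover have "dist (x, t) (z, v) \<le> dist x z + dist t v"
      by (simp add: dist_Pair_Pair sqrt_sum_squares_le_sum)
    ultimately have "dist (x, t) (z, v) \<le> 2 * m"
      by linarith
    also have "\<dots> = 2 / (1 - k) * ((1 - k) * m)"
      using k by simp
    also have "\<dots> \<le> 2 / (1 - k) * (dist x t - dist z v)"
      using descent k unfolding m_def by (intro mult_left_mono) auto
    also have "\<dots> = \<phi> (x, t) - \<phi> (z, v)"
      by (simp add: \<phi>_def right_diff_distrib)
    finally show False
      using no_descent[OF z(1) v] z(2) by blast
  qed
  then show "\<exists>x\<in>X. x \<in> F x"
    using x by blast
qed

end
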